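(* Let $F$ be a field of characteristic not $2$. Let $A$ be a prime nonassociative (i.e. not associative) Novikov algebra over $F$ and let $I$ be a nonzero ideal of $A$. Then $I$, regarded as an algebra, is a prime non-associative Novikov algebra.
   Context: Algebras over a field are not assumed associative or unital. For elements $x,y,z$ of an algebra, the associator is $(x,y,z)=(xy)z-x(yz)$. An algebra $A$ over a field is a Novikov algebra if $(x,y,z)=(y,x,z)$ and $(xy)z=(xz)y$ for all $x,y,z\in A$. "Nonassociative" (or "non-associative") means that the algebra is not associative, i.e. some associator is nonzero. "Ideal" means two-sided ideal. For subspaces $I,J$, the product $IJ$ is the linear span of all products $ij$ with $i\in I$, $j\in J$. An algebra is prime if $IJ\neq 0$ for all nonzero ideals $I,J$. *)

theory Defs
  imports Complex_Main
begin

text \<open>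
  The carrier \<open>A\<close> is a subspace of an ambient vector space over the field \<open>'f\<close>, and nothing is
  assumed about \<open>mult\<close> outside of \<open>A\<close>. An arbitrary algebra is the case \<open>A = UNIV\<close>; a subspace
  \<open>I\<close> of \<open>A\<close> that is regarded as an algebra is described by the same \<open>scale\<close> and \<open>mult\<close>, with
  carrier \<open>I\<close>.
\<close>

locale algebra_over = vector_space scale
  for scale :: "'f::field \<Rightarrow> 'a::ab_group_add \<Rightarrow> 'a" (infixr \<open>*s\<close> 75) +
  fixes mult :: "'a \<Rightarrow> 'a \<Rightarrow> 'a" (infixl \<open>\<cdot>\<close> 70)
    and A :: "'a set"
  assumes subspace_carrier: "subspace A"
    and mult_closed: "\<lbrakk>x \<in> A; y \<in> A\<rbrakk> \<Longrightarrow> x \<cdot> y \<in> A"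
    and mult_add_left: "\<lbrakk>x \<in> A; y \<in> A; z \<in> A\<rbrakk> \<Longrightarrow> (x + y) \<cdot> z = x \<cdot> z + y \<cdot> z"
    and mult_add_right: "\<lbrakk>x \<in> A; y \<in> A; z \<in> A\<rbrakk> \<Longrightarrow> x \<cdot> (y + z) = x \<cdot> y + x \<cdot> z"
    and mult_scale_left: "\<lbrakk>x \<in> A; y \<in> A\<rbrakk> \<Longrightarrow> (c *s x) \<cdot> y = c *s (x \<cdot> y)"
    and mult_scale_right: "\<lbrakk>x \<in> A; y \<in> A\<rbrakk> \<Longrightarrow> x \<cdot> (c *s y) = c *s (x \<cdot> y)"
begin

definition associator :: "'a \<Rightarrow> 'a \<Rightarrow> 'a \<Rightarrow> 'a" where
  "associator x y z = (x \<cdot> y) \<cdot> z - x \<cdot> (y \<cdot> z)"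

definition is_ideal :: "'a set \<Rightarrow> bool" where
  "is_ideal I \<longleftrightarrow> subspace I \<and> I \<subseteq> A \<and> (\<forall>a\<in>A. \<forall>x\<in>I. a \<cdot> x \<in> I \<and> x \<cdot> a \<in> I)"

definition subspace_prod :: "'a set \<Rightarrow> 'a set \<Rightarrow> 'a set" where
  "subspace_prod I J = span {x \<cdot> y | x y. x \<in> I \<and> y \<in> J}"

end

locale nonassociative_algebra = algebra_over +
  assumes not_associative: "\<exists>x\<in>A. \<exists>y\<in>A. \<exists>z\<in>A. associator x y z \<noteq> 0"

locale prime_algebra = algebra_over +
  assumes prime_ideals:
    "\<lbrakk>is_ideal I; is_ideal J; I \<noteq> {0}; J \<noteq> {0}\<rbrakk> \<Longrightarrow> subspace_prod I J \<noteq> {0}"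

locale novikov_algebra = algebra_over +
  assumes left_symmetric:
      "\<lbrakk>x \<in> A; y \<in> A; z \<in> A\<rbrakk> \<Longrightarrow> associator x y z = associator y x z"
    and right_commutative:
      "\<lbrakk>x \<in> A; y \<in> A; z \<in> A\<rbrakk> \<Longrightarrow> (x \<cdot> y) \<cdot> z = (x \<cdot> z) \<cdot> y"

end

theory Submission
  imports Defs
begin

text \<open>
  Right multiplications commute with associators: \<open>(x, y, z) w = (x w, y, z)\<close>. Together with left
  symmetry, this lets a right factor from an ideal \<open>I\<close> be moved into either of the first two
  arguments of an associator. In a prime algebra \<open>x I = 0\<close> forces \<open>x = 0\<close>, because the left
  annihilator of an ideal is an ideal; so an identity that holds after multiplication by \<open>I\<close> holds.
  In particular, if \<open>I\<close> is associative, then \<open>(A, A, I) = 0\<close>, and the Teichmueller identity yields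
  \<open>(A, A, A) I = 0\<close>.

  Suppose that \<open>J K = 0\<close> for nonzero ideals \<open>J\<close>, \<open>K\<close> of \<open>I\<close>. The left annihilator \<open>L\<close> of \<open>K\<close> in \<open>I\<close> is
  a nonzero ideal of \<open>A\<close>. If \<open>K \<inter> L = 0\<close>, then \<open>K L = 0\<close> and \<open>K = 0\<close>. Otherwise the nonzero
  \<open>y \<in> K \<inter> L\<close> satisfy \<open>L y = 0\<close> and \<open>L (y L) = 0\<close>; but all such \<open>y \<in> L\<close> form an ideal of \<open>A\<close>,
  which is zero by primeness.
\<close>

section \<open>Bilinearity, associators and ideals\<close>

context algebra_over
begin

lemma zero_carrier: "0 \<in> A"
  using subspace_carrier by (rule subspace_0)

lemma diff_carrier: "\<lbrakk>x \<in> A; y \<in> A\<rbrakk> \<Longrightarrow> x - y \<in> A"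
  using subspace_carrier by (rule subspace_diff)

lemma mult_zero_left: "x \<in> A \<Longrightarrow> 0 \<cdot> x = 0"
  using mult_add_left[of 0 0 x] zero_carrier by simp

lemma mult_zero_right: "x \<in> A \<Longrightarrow> x \<cdot> 0 = 0"
  using mult_add_right[of x 0 0] zero_carrier by simp

lemma mult_diff_left: "\<lbrakk>x \<in> A; y \<in> A; z \<in> A\<rbrakk> \<Longrightarrow> (x - y) \<cdot> z = x \<cdot> z - y \<cdot> z"
  using mult_add_left[of "x - y" y z] diff_carrier[of x y] by (simp add: algebra_simps)

lemma mult_diff_right: "\<lbrakk>x \<in> A; y \<in> A; z \<in> A\<rbrakk> \<Longrightarrow> x \<cdot> (y - z) = x \<cdot> y - x \<cdot> z"
  using mult_add_right[of x "y - z" z] diff_carrier[of y z] by (simp add: algebra_simps)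

lemma associator_carrier: "\<lbrakk>x \<in> A; y \<in> A; z \<in> A\<rbrakk> \<Longrightarrow> associator x y z \<in> A"
  by (simp add: associator_def mult_closed diff_carrier)

lemma teichmueller:
  assumes "w \<in> A" "x \<in> A" "y \<in> A" "z \<in> A"
  shows "associator (w \<cdot> x) y z - associator w (x \<cdot> y) z + associator w x (y \<cdot> z) =
    w \<cdot> associator x y z + associator w x y \<cdot> z"
  using assms by (simp add: associator_def mult_diff_left mult_diff_right mult_closed)

lemma is_ideal_subspace: "is_ideal I \<Longrightarrow> subspace I"
  by (simp add: is_ideal_def)

lemma is_ideal_subset: "\<lbrakk>is_ideal I; x \<in> I\<rbrakk> \<Longrightarrow> x \<in> A"
  by (auto simp: is_ideal_def)

lemma is_ideal_mult_left: "\<lbrakk>is_ideal I; a \<in> A; x \<in> I\<rbrakk> \<Longrightarrow> a \<cdot> x \<in> I"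
  by (simp add: is_ideal_def)

lemma is_ideal_mult_right: "\<lbrakk>is_ideal I; a \<in> A; x \<in> I\<rbrakk> \<Longrightarrow> x \<cdot> a \<in> I"
  by (simp add: is_ideal_def)

lemma algebra_over_ideal:
  assumes I: "is_ideal I"
  shows "algebra_over scale mult I"
  by (intro algebra_over.intro algebra_over_axioms.intro vector_space_axioms)
    (simp_all add: is_ideal_subspace[OF I] is_ideal_subset[OF I] is_ideal_mult_left[OF I]
      mult_add_left mult_add_right mult_scale_left mult_scale_right)

lemma subspace_prod_eq_zero_iff:
  assumes "0 \<in> I" "0 \<in> J"
  shows "subspace_prod I J = {0} \<longleftrightarrow> (\<forall>x\<in>I. \<forall>y\<in>J. x \<cdot> y = 0)"
proof
  assume *: "subspace_prod I J = {0}"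
  have "x \<cdot> y \<in> subspace_prod I J" if "x \<in> I" "y \<in> J" for x y
    unfolding subspace_prod_def using that by (intro span_base) auto
  with * show "\<forall>x\<in>I. \<forall>y\<in>J. x \<cdot> y = 0"
    by simp
next
  assume "\<forall>x\<in>I. \<forall>y\<in>J. x \<cdot> y = 0"
  then have "{x \<cdot> y | x y. x \<in> I \<and> y \<in> J} \<subseteq> {0}"
    by auto
  then have "subspace_prod I J \<subseteq> {0}"
    unfolding subspace_prod_def by (rule span_minimal) (rule subspace_single_0)
  then show "subspace_prod I J = {0}"
    unfolding subspace_prod_def using span_zero by blast
qed

lemma subspace_left_annihilator:
  assumes "subspace S" "S \<subseteq> A" "K \<subseteq> A"
  shows "subspace {x \<in> S. \<forall>k\<in>K. x \<cdot> k = 0}"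
proof (rule subspaceI)
  show "0 \<in> {x \<in> S. \<forall>k\<in>K. x \<cdot> k = 0}"
    using assms mult_zero_left subspace_0 by auto
next
  fix x y assume "x \<in> {x \<in> S. \<forall>k\<in>K. x \<cdot> k = 0}" "y \<in> {x \<in> S. \<forall>k\<in>K. x \<cdot> k = 0}"
  then show "x + y \<in> {x \<in> S. \<forall>k\<in>K. x \<cdot> k = 0}"
    using assms subspace_add[OF assms(1)] mult_add_left[of x y] by (auto simp: subset_iff)
next
  fix c x assume "x \<in> {x \<in> S. \<forall>k\<in>K. x \<cdot> k = 0}"
  then show "c *s x \<in> {x \<in> S. \<forall>k\<in>K. x \<cdot> k = 0}"
    using assms subspace_scale[OF assms(1)] mult_scale_left[of x _ c] by (auto simp: subset_iff)
qed

end

lemma (in prime_algebra) prime_ideals_mult: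
  assumes "is_ideal I" "is_ideal J" "\<And>x y. \<lbrakk>x \<in> I; y \<in> J\<rbrakk> \<Longrightarrow> x \<cdot> y = 0"
  shows "I = {0} \<or> J = {0}"
  using prime_ideals[OF assms(1,2)] subspace_prod_eq_zero_iff[of I J] assms
    subspace_0 is_ideal_subspace by blast

section \<open>Associators and annihilators in Novikov algebras\<close>

context novikov_algebra
begin

text \<open>Since right multiplications commute, \<open>w\<close> can be carried inward in
  \<open>((x y) z) w\<close> and in \<open>(x (y z)) w\<close> until it acts on \<open>x\<close>
  alone. Left symmetry gives the version for \<open>y\<close>.\<close>

lemma associator_mult:
  assumes "x \<in> A" "y \<in> A" "z \<in> A" "w \<in> A"
  shows "associator x y z \<cdot> w = associator (x \<cdot> w) y z"
    and "associator x y z \<cdot> w = associator x (y \<cdot> w) z"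
proof -
  have *: "associator x y z \<cdot> w = associator (x \<cdot> w) y z"
    if "x \<in> A" "y \<in> A" for x y
    using that assms(3,4) right_commutative[of "x \<cdot> y" z w] right_commutative[of x y w]
      right_commutative[of x "y \<cdot> z" w]
    by (simp add: associator_def mult_diff_left mult_closed)
  show "associator x y z \<cdot> w = associator (x \<cdot> w) y z"
    using assms by (intro *)
  show "associator x y z \<cdot> w = associator x (y \<cdot> w) z"
    using *[of y x] assms left_symmetric mult_closed by metis
qed

lemma left_mult_swap:
  assumes "x \<in> A" "y \<in> A" "z \<in> A"
  shows "x \<cdot> (y \<cdot> z) = (x \<cdot> y) \<cdot> z - (y \<cdot> x) \<cdot> z + y \<cdot> (x \<cdot> z)"
  using left_symmetric[OF assms] by (simp add: associator_def algebra_simps)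

lemma novikov_algebra_ideal:
  assumes I: "is_ideal I"
  shows "novikov_algebra scale mult I"
proof -
  interpret I: algebra_over scale mult I
    using I by (rule algebra_over_ideal)
  show ?thesis
    using is_ideal_subset[OF I]
    by unfold_locales (blast intro: left_symmetric right_commutative)+
qed

text \<open>Right commutativity gives \<open>(x a) i = (x i) a = 0\<close>. Then all terms of
  \<open>(a x) i = a (x i) + (x a) i - x (a i)\<close> vanish, because \<open>a i\<close> lies in
  \<open>I\<close>.\<close>

lemma is_ideal_left_annihilator:
  assumes I: "is_ideal I"
  shows "is_ideal {x \<in> A. \<forall>i\<in>I. x \<cdot> i = 0}"
proof -
  have "(a \<cdot> x) \<cdot> i = 0" "(x \<cdot> a) \<cdot> i = 0"
    if "a \<in> A" "x \<in> A" "\<forall>i\<in>I. x \<cdot> i = 0" "i \<in> I" for a x i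
  proof -
    have i: "i \<in> A" "a \<cdot> i \<in> I"
      using I that is_ideal_subset is_ideal_mult_left by auto
    show "(x \<cdot> a) \<cdot> i = 0"
      using right_commutative[of x a i] that i mult_zero_left by simp
    then show "(a \<cdot> x) \<cdot> i = 0"
      using left_mult_swap[of a x i] that i mult_zero_right[of a] by simp
  qed
  moreover have "subspace {x \<in> A. \<forall>i\<in>I. x \<cdot> i = 0}"
    using I is_ideal_subset subspace_carrier by (intro subspace_left_annihilator) auto
  ultimately show ?thesis
    unfolding is_ideal_def using mult_closed by auto
qed

end

section \<open>Ideals of prime Novikov algebras\<close>

locale prime_novikov_algebra = prime_algebra + novikov_algebra
begin

text \<open>The left annihilator \<open>N\<close> of \<open>I\<close> is an ideal with
  \<open>N I = 0\<close>, so primeness makes it zero.\<close>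

lemma left_annihilator_ideal_trivial:
  assumes "is_ideal I" "I \<noteq> {0}" "x \<in> A" "\<And>i. i \<in> I \<Longrightarrow> x \<cdot> i = 0"
  shows "x = 0"
  using prime_ideals_mult[OF is_ideal_left_annihilator[OF assms(1)] assms(1)] assms by blast

text \<open>As \<open>K\<close> is an ideal of \<open>I\<close> only, \<open>a k\<close> need not
  lie in \<open>K\<close>, and the direct argument covers only left factors from \<open>I\<close>.
  For \<open>a\<close> in \<open>A\<close>, a further right factor \<open>i\<close> from
  \<open>I\<close> replaces \<open>a\<close> by \<open>a i\<close>, which lies in
  \<open>I\<close>.\<close>

lemma is_ideal_left_annihilator_in_ideal:
  assumes I: "is_ideal I" "I \<noteq> {0}" and K: "algebra_over.is_ideal scale mult I K"
  shows "is_ideal {x \<in> I. \<forall>k\<in>K. x \<cdot> k = 0}" (is "is_ideal ?L")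
proof -
  interpret I: novikov_algebra scale mult I
    using I(1) by (rule novikov_algebra_ideal)
  note IA = is_ideal_subset[OF I(1)]
  have KI: "k \<in> I" if "k \<in> K" for k
    using K that by (rule I.is_ideal_subset)
  have sub: "subspace ?L"
    using I IA KI is_ideal_subspace by (intro subspace_left_annihilator) auto
  have right: "(x \<cdot> a) \<cdot> k = 0" if "x \<in> ?L" "a \<in> A" "k \<in> K" for x a k
    using right_commutative[of x a k] that IA KI mult_zero_left by auto
  have leftI: "(i \<cdot> x) \<cdot> k = 0" if "x \<in> ?L" "i \<in> I" "k \<in> K" for x i k
  proof -
    have "i \<cdot> k \<in> K"
      using K that I.is_ideal_mult_left by blast
    then show ?thesis
      using left_mult_swap[of i x k] right[of x i k] that IA KI mult_zero_right by auto
  qed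
  have left: "(a \<cdot> x) \<cdot> k = 0" if x: "x \<in> ?L" and a: "a \<in> A" and k: "k \<in> K" for x a k
  proof (rule left_annihilator_ideal_trivial[OF I])
    show "(a \<cdot> x) \<cdot> k \<in> A"
      using x a k IA KI mult_closed by auto
    fix i assume i: "i \<in> I"
    have "((a \<cdot> x) \<cdot> k) \<cdot> i = ((a \<cdot> x) \<cdot> i) \<cdot> k"
      using x a k i IA KI mult_closed by (auto intro: right_commutative)
    also have "(a \<cdot> x) \<cdot> i = (a \<cdot> i) \<cdot> x"
      using x a i IA by (auto intro: right_commutative)
    also have "(a \<cdot> i) \<cdot> x \<cdot> k = 0"
      using x a k i I(1) is_ideal_mult_left by (auto intro: leftI)
    finally show "((a \<cdot> x) \<cdot> k) \<cdot> i = 0" .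
  qed
  show ?thesis
    unfolding is_ideal_def
    using sub IA left right is_ideal_mult_left[OF I(1)] is_ideal_mult_right[OF I(1)] by auto
qed

text \<open>The elements of \<open>I\<close> with these properties form an ideal \<open>R\<close> of
  \<open>A\<close> with \<open>I R = 0\<close>, so primeness applies. The condition on
  \<open>i (y j)\<close> supplies closure under right multiplication by \<open>I\<close>, which is
  then extended to \<open>A\<close>.\<close>

lemma right_annihilated_by_ideal_trivial:
  assumes I: "is_ideal I" "I \<noteq> {0}"
    and "y \<in> I" "\<And>i. i \<in> I \<Longrightarrow> i \<cdot> y = 0" "\<And>i j. \<lbrakk>i \<in> I; j \<in> I\<rbrakk> \<Longrightarrow> i \<cdot> (y \<cdot> j) = 0"
  shows "y = 0"
proof -
  define R where "R = {y \<in> I. \<forall>i\<in>I. i \<cdot> y = 0 \<and> (\<forall>j\<in>I. i \<cdot> (y \<cdot> j) = 0)}"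
  note IA = is_ideal_subset[OF I(1)]
  note IL = is_ideal_mult_left[OF I(1)] and IR = is_ideal_mult_right[OF I(1)]
  have RI: "y \<in> I" and R1: "i \<cdot> y = 0" and R2: "i \<cdot> (y \<cdot> j) = 0"
    if "y \<in> R" "i \<in> I" "j \<in> I" for y i j
    using that by (auto simp: R_def)
  have RA: "y \<in> A" if "y \<in> R" for y
    using that IA by (auto simp: R_def)
  have sub: "subspace R"
  proof (rule subspaceI)
    show "0 \<in> R"
      using subspace_0[OF is_ideal_subspace[OF I(1)]] IA mult_zero_left mult_zero_right
      by (auto simp: R_def)
    show "x + y \<in> R" if "x \<in> R" "y \<in> R" for x y
      using that subspace_add[OF is_ideal_subspace[OF I(1)]] IA
      by (auto simp: R_def mult_add_left mult_add_right mult_closed)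
    show "c *s x \<in> R" if "x \<in> R" for c x
      using that subspace_scale[OF is_ideal_subspace[OF I(1)]] IA
      by (auto simp: R_def mult_scale_left mult_scale_right mult_closed)
  qed
  have right_I: "y \<cdot> i \<in> R" if y: "y \<in> R" and i: "i \<in> I" for y i
  proof -
    have "k \<cdot> ((y \<cdot> i) \<cdot> j) = 0" if k: "k \<in> I" and j: "j \<in> I" for k j
    proof -
      have "associator k (y \<cdot> i) j = associator k y j \<cdot> i"
        using associator_mult(2)[of k y j i] y i k j IA RA by simp
      also have "\<dots> = 0"
        using R1[OF y k j] R2[OF y k j] mult_zero_left IA[OF i] IA[OF j] by (simp add: associator_def)
      finally show ?thesis
        using R2[OF y k i] mult_zero_left IA[OF j] by (simp add: associator_def)
    qed
    then show ?thesis
      using y i IL IA RA R2 by (auto simp: R_def)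
  qed
  have AR: "a \<cdot> y = 0" if a: "a \<in> A" and y: "y \<in> R" for a y
  proof (rule left_annihilator_ideal_trivial[OF I])
    show "a \<cdot> y \<in> A"
      using a y RA mult_closed by simp
    fix i assume i: "i \<in> I"
    then show "(a \<cdot> y) \<cdot> i = 0"
      using right_commutative[of a y i] a y RA IA R1[OF y IL[OF a i]] by simp
  qed
  \<comment> \<open>A right factor \<open>j\<close> from \<open>I\<close> is absorbed by
    \<open>a\<close>. Left symmetry then puts \<open>a j\<close>, an element of \<open>I\<close>, in
    front of \<open>y\<close>, where it kills both terms.\<close>
  have assoc_I: "associator y a i = 0" if y: "y \<in> R" and a: "a \<in> A" and i: "i \<in> I" for y a i
  proof (rule left_annihilator_ideal_trivial[OF I])
    show "associator y a i \<in> A"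
      using y a i RA IA associator_carrier by simp
    fix j assume j: "j \<in> I"
    have "associator y a i \<cdot> j = associator y (a \<cdot> j) i"
      using y a i j RA IA associator_mult(2) by simp
    also have "\<dots> = associator (a \<cdot> j) y i"
      using y a i j RA IA mult_closed by (simp add: left_symmetric)
    also have "\<dots> = 0"
      using R1[OF y IL[OF a j]] R2[OF y IL[OF a j] i] i IA mult_zero_left
      by (simp add: associator_def)
    finally show "associator y a i \<cdot> j = 0" .
  qed
  \<comment> \<open>In the Teichmueller identity for \<open>y\<close>, \<open>a\<close>,
    \<open>b\<close>, \<open>i\<close>, the three associators on the left vanish by
    \<open>assoc_I\<close>, the first after \<open>a\<close> is moved outside.\<close>
  have teich: "associator y a b \<cdot> i = - (y \<cdot> associator a b i)"
    if y: "y \<in> R" and a: "a \<in> A" and b: "b \<in> A" and i: "i \<in> I" for y a b i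
  proof -
    have "associator (y \<cdot> a) b i = associator y b i \<cdot> a"
      using y a b i RA IA associator_mult(1)[of y b i a] by simp
    also have "\<dots> = 0"
      using assoc_I[OF y b i] a mult_zero_left by simp
    finally show ?thesis
      using teichmueller[of y a b i] y a b i RA IA IL mult_closed assoc_I[OF y]
      by (simp add: eq_neg_iff_add_eq_0 add.commute)
  qed
  \<comment> \<open>By \<open>teich\<close>, the product with \<open>i\<close> depends on
    \<open>a\<close> and \<open>b\<close> only through \<open>(a, b, i)\<close>, which is symmetric
    in them.\<close>
  have assoc_sym: "associator y a b = associator y b a"
    if y: "y \<in> R" and a: "a \<in> A" and b: "b \<in> A" for y a b
  proof -
    have "associator y a b - associator y b a = 0"
    proof (rule left_annihilator_ideal_trivial[OF I])
      show "associator y a b - associator y b a \<in> A"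
        using y a b RA associator_carrier diff_carrier by simp
      show "(associator y a b - associator y b a) \<cdot> i = 0" if i: "i \<in> I" for i
        using teich[OF y a b i] teich[OF y b a i] left_symmetric[of a b i] y a b i RA IA
        by (simp add: mult_diff_left associator_carrier)
    qed
    then show ?thesis by simp
  qed
  \<comment> \<open>\<open>(i, y, a) = (y, i, a) = (y, a, i) = 0\<close>, hence
    \<open>i (y a) = (i y) a = 0\<close>.\<close>
  have IRA: "i \<cdot> (y \<cdot> a) = 0" if y: "y \<in> R" and a: "a \<in> A" and i: "i \<in> I" for y a i
  proof -
    have "associator i y a = 0"
      using assoc_sym[of y i a] assoc_I[of y a i] left_symmetric[of i y a] y a i RA IA by simp
    then show ?thesis
      using R1[OF y i i] a mult_zero_left by (simp add: associator_def)
  qed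
  have RAR: "y \<cdot> a \<in> R" if y: "y \<in> R" and a: "a \<in> A" for y a
  proof -
    \<comment> \<open>\<open>(y a) j = (y j) a\<close>, and \<open>y j\<close> is again in
      \<open>R\<close>, so \<open>IRA\<close> applies to it.\<close>
    have "i \<cdot> ((y \<cdot> a) \<cdot> j) = 0" if "i \<in> I" "j \<in> I" for i j
      using IRA[OF right_I[OF y that(2)] a that(1)] right_commutative[of y a j] y a that RA IA
      by simp
    then show ?thesis
      using IRA[OF y a] y a IR by (auto simp: R_def)
  qed
  have "is_ideal R"
    unfolding is_ideal_def using sub RA RAR AR subspace_0[OF sub] by auto
  then have "R = {0}"
    using prime_ideals_mult[of I R] I R1 by blast
  moreover have "y \<in> R"
    using assms by (simp add: R_def)
  ultimately show ?thesis by simp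
qed

lemma prime_algebra_ideal:
  assumes I: "is_ideal I" "I \<noteq> {0}"
  shows "prime_algebra scale mult I"
proof -
  interpret I: novikov_algebra scale mult I
    using I(1) by (rule novikov_algebra_ideal)
  show ?thesis
  proof unfold_locales
    fix J K assume J: "I.is_ideal J" and K: "I.is_ideal K" and nz: "J \<noteq> {0}" "K \<noteq> {0}"
    show "I.subspace_prod J K \<noteq> {0}"
    proof
      assume "I.subspace_prod J K = {0}"
      then have JK: "\<forall>x\<in>J. \<forall>y\<in>K. x \<cdot> y = 0"
        using subspace_0[OF I.is_ideal_subspace[OF J]] subspace_0[OF I.is_ideal_subspace[OF K]]
        by (simp add: I.subspace_prod_eq_zero_iff)
      \<comment> \<open>\<open>J\<close> is an ideal of \<open>I\<close> only; \<open>L\<close>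
        contains it and is an ideal of \<open>A\<close>, so primeness of \<open>A\<close> can be
        used.\<close>
      define L where "L = {x \<in> I. \<forall>k\<in>K. x \<cdot> k = 0}"
      have L: "is_ideal L"
        unfolding L_def by (rule is_ideal_left_annihilator_in_ideal[OF I K])
      have "J \<subseteq> L"
        using JK I.is_ideal_subset[OF J] by (auto simp: L_def)
      then have "L \<noteq> {0}"
        using nz(1) subspace_0[OF I.is_ideal_subspace[OF J]] by blast
      have "y = 0" if y: "y \<in> K" "y \<in> L" for y
      proof (rule right_annihilated_by_ideal_trivial[OF L \<open>L \<noteq> {0}\<close> y(2)])
        show "i \<cdot> y = 0" if "i \<in> L" for i
          using that y by (simp add: L_def)
        show "i \<cdot> (y \<cdot> j) = 0" if "i \<in> L" "j \<in> L" for i j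
          using that y I.is_ideal_mult_right[OF K] by (simp add: L_def)
      qed
      \<comment> \<open>Products from \<open>K\<close> and \<open>L\<close> land in
        \<open>K \<inter> L\<close>, which is zero.\<close>
      moreover have "k \<cdot> x \<in> K" "k \<cdot> x \<in> L" if "k \<in> K" "x \<in> L" for k x
        using that I.is_ideal_mult_right[OF K, of x k] is_ideal_mult_left[OF L, of k x]
          I.is_ideal_subset[OF K] is_ideal_subset[OF I(1)] by (auto simp: L_def)
      ultimately have "k \<cdot> x = 0" if "k \<in> K" "x \<in> L" for k x
        using that by blast
      then have "k = 0" if "k \<in> K" for k
        using that left_annihilator_ideal_trivial[OF L \<open>L \<noteq> {0}\<close>, of k]
          I.is_ideal_subset[OF K] is_ideal_subset[OF I(1)] by blast
      then show False
        using nz(2) subspace_0[OF I.is_ideal_subspace[OF K]] by blast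
    qed
  qed
qed

text \<open>The arguments of the associator are released from \<open>I\<close> one at a time: the
  middle one, then the first, then the last.\<close>

lemma associative_if_ideal_associative:
  assumes I: "is_ideal I" "I \<noteq> {0}"
    and assoc: "\<And>x y z. \<lbrakk>x \<in> I; y \<in> I; z \<in> I\<rbrakk> \<Longrightarrow> associator x y z = 0"
    and A: "x \<in> A" "y \<in> A" "z \<in> A"
  shows "associator x y z = 0"
proof -
  note IA = is_ideal_subset[OF I(1)] and IL = is_ideal_mult_left[OF I(1)]
  note trivial = left_annihilator_ideal_trivial[OF I associator_carrier]
  have IAI: "associator i a j = 0" if "i \<in> I" "a \<in> A" "j \<in> I" for i a j
    using that by (intro trivial) (simp_all add: IA IL associator_mult(2) assoc)
  have AAI: "associator a b i = 0" if "a \<in> A" "b \<in> A" "i \<in> I" for a b i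
    using that by (intro trivial) (simp_all add: IA IL associator_mult(1) IAI)
  show ?thesis
  proof (rule trivial)
    \<comment> \<open>Every other term of the Teichmueller identity contains an associator with last
      argument in \<open>I\<close>.\<close>
    show "associator x y z \<cdot> i = 0" if "i \<in> I" for i
      using teichmueller[of x y z i] that A IA IL mult_closed mult_zero_right AAI by simp
  qed (use A in simp_all)
qed

end

theorem theorem1:
  fixes scale :: "'f::field \<Rightarrow> 'a::ab_group_add \<Rightarrow> 'a"
    and mult :: "'a \<Rightarrow> 'a \<Rightarrow> 'a"
    and A I :: "'a set"
  assumes "CHAR('f) \<noteq> 2"
    and "novikov_algebra scale mult A"
    and "prime_algebra scale mult A"
    and "nonassociative_algebra scale mult A"
    and "algebra_over.is_ideal scale mult A I"
    and "I \<noteq> {0}"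
  shows "novikov_algebra scale mult I \<and> prime_algebra scale mult I \<and>
    nonassociative_algebra scale mult I"
proof -
  interpret nonassociative_algebra scale mult A by fact
  interpret prime_novikov_algebra scale mult A
    using assms(3,2) by (rule prime_novikov_algebra.intro)
  note I = assms(5,6)
  have "nonassociative_algebra_axioms mult I"
    unfolding nonassociative_algebra_axioms_def
    using associative_if_ideal_associative[OF I] not_associative by metis
  then show ?thesis
    using novikov_algebra_ideal prime_algebra_ideal algebra_over_ideal I
    by (simp add: nonassociative_algebra_def)
qed

end
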